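(* Let $A \in \mathbb{Z}^{m\times n}$ be an integer matrix such that the all-ones vector $\mathbf{1}$ lies in $\operatorname{rowspan}(A)$. Let $\mathcal{M} = \{p \in \Delta_{n-1} : \log(p) \in \operatorname{rowspan}(A)\}$ be the associated log-linear (toric) model. Then for any point $p \in \mathcal{M}$, the logarithmic Voronoi cell of $p$ is equal to the log-normal polytope at $p$ (up to points in the boundary of the simplex), i.e. $$\log \mathrm{Vor}_{\mathcal{M}}(p) = \log N_p\mathcal{M} \cap \Delta_{n-1}.$$
   Context: $\Delta_{n-1} = \{u \in \mathbb{R}^n : \sum_{i=1}^n u_i = 1,\ u_i > 0 \text{ for all } i\}$ is the open probability simplex and $\overline{\Delta_{n-1}}$ its closure. $\log(p) = (\log p_1,\dots,\log p_n)$. For $u \in \Delta_{n-1}$ let $\ell_u(q) = \sum_{i=1}^n u_i \log(q_i)$. For a model $\mathcal{M} \subset \Delta_{n-1}$ write $\Phi(u)=p$ if $p \in \mathcal{M}$ and $p \in \operatorname{argmax}_{q \in \mathcal{M}} \ell_u(q)$. The logarithmic Voronoi cell of $p \in \mathcal{M}$ is $\log \mathrm{Vor}_{\mathcal{M}}(p) = \{u \in \Delta_{n-1} : \Phi(u) = p\}$. $N_p\mathcal{M}$ is the orthogonal complement, for the Euclidean inner product, of the tangent space of $\mathcal{M}$ at $p$. The log-normal space at $p$ is $\log N_p\mathcal{M} = \{u \in \mathbb{R}^n : \nabla \ell_u(p) \in N_p\mathcal{M}\}$, where $\nabla \ell_u(p) = (u_1/p_1,\dots,u_n/p_n)$. The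 log-normal polytope at $p$ is $\log N_p\mathcal{M} \cap \overline{\Delta_{n-1}}$. Saying that a logarithmic Voronoi cell equals its log-normal polytope means equality as sets, excepting the points in the boundary of the simplex. *)

theory Defs
  imports "HOL-Analysis.Analysis"
begin

definition open_simplex :: "(real ^ 'n) set" where
  "open_simplex = {u. (\<Sum>i\<in>UNIV. u $ i) = 1 \<and> (\<forall>i. u $ i > 0)}"

definition log_vec :: "real ^ 'n \<Rightarrow> real ^ 'n" where
  "log_vec p = (\<chi> i. ln (p $ i))"

definition log_lik :: "real ^ 'n \<Rightarrow> real ^ 'n \<Rightarrow> real" where
  "log_lik u q = (\<Sum>i\<in>UNIV. u $ i * ln (q $ i))"

definition log_lik_grad :: "real ^ 'n \<Rightarrow> real ^ 'n \<Rightarrow> real ^ 'n" where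
  "log_lik_grad u p = (\<chi> i. u $ i / p $ i)"

lemma GDERIV_log_lik:
  fixes u p :: "real ^ 'n"
  assumes "\<And>i. p $ i > 0"
  shows "GDERIV (log_lik u) p :> log_lik_grad u p"
proof -
  have "((\<lambda>q. \<Sum>i\<in>UNIV. u $ i * ln (q $ i)) has_derivative
      (\<lambda>h. \<Sum>i\<in>UNIV. u $ i * (h $ i * inverse (p $ i)))) (at p)"
    using assms
    by (auto intro!: derivative_eq_intros bounded_linear.has_derivative[OF bounded_linear_vec_nth]
        simp: divide_inverse mult.commute)
  moreover have "(\<lambda>h. \<Sum>i\<in>UNIV. u $ i * (h $ i * inverse (p $ i))) = (\<lambda>h. inner h (log_lik_grad u p))"
    by (simp add: log_lik_grad_def inner_vec_def divide_inverse mult_ac)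
  ultimately show ?thesis
    by (simp add: gderiv_def log_lik_def[abs_def])
qed

text \<open>\<open>is_mle M u p\<close> is the relation \<open>\<Phi>(u) = p\<close>. It says that \<open>p\<close> is a maximizer; uniqueness of
  the maximizer is not part of it.\<close>

definition is_mle :: "(real ^ 'n) set \<Rightarrow> real ^ 'n \<Rightarrow> real ^ 'n \<Rightarrow> bool" where
  "is_mle M u p \<longleftrightarrow> is_arg_max (log_lik u) (\<lambda>q. q \<in> M) p"

definition log_voronoi_cell :: "(real ^ 'n) set \<Rightarrow> real ^ 'n \<Rightarrow> (real ^ 'n) set" where
  "log_voronoi_cell M p = {u \<in> open_simplex. is_mle M u p}"

text \<open>Tangent vectors are the velocities at \<open>p\<close> of \<open>C\<^sup>1\<close> curves in \<open>M\<close> through \<open>p\<close>. For an embedded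
  submanifold this is the usual tangent space.\<close>

definition tangent_space :: "'a::real_normed_vector set \<Rightarrow> 'a \<Rightarrow> 'a set" where
  "tangent_space M p = {v. \<exists>\<gamma> \<epsilon>. \<epsilon> > 0 \<and> \<gamma> C1_differentiable_on {-\<epsilon><..<\<epsilon>} \<and>
     \<gamma> ` {-\<epsilon><..<\<epsilon>} \<subseteq> M \<and> \<gamma> 0 = p \<and> (\<gamma> has_vector_derivative v) (at 0)}"

definition normal_space :: "'a::real_inner set \<Rightarrow> 'a \<Rightarrow> 'a set" where
  "normal_space M p = orthogonal_comp (tangent_space M p)"

definition log_normal_space :: "(real ^ 'n) set \<Rightarrow> real ^ 'n \<Rightarrow> (real ^ 'n) set" where
  "log_normal_space M p = {u. log_lik_grad u p \<in> normal_space M p}"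

definition log_normal_polytope :: "(real ^ 'n) set \<Rightarrow> real ^ 'n \<Rightarrow> (real ^ 'n) set" where
  "log_normal_polytope M p = log_normal_space M p \<inter> closure open_simplex"

lemma log_normal_polytope_Int_open_simplex:
  "log_normal_polytope M p \<inter> open_simplex = log_normal_space M p \<inter> open_simplex"
  using closure_subset[of open_simplex] by (auto simp: log_normal_polytope_def)

definition row_span :: "int ^ 'n ^ 'm \<Rightarrow> (real ^ 'n) set" where
  "row_span A = span (rows (map_matrix real_of_int A))"

definition log_linear_model :: "int ^ 'n ^ 'm \<Rightarrow> (real ^ 'n) set" where
  "log_linear_model A = {p \<in> open_simplex. log_vec p \<in> row_span A}"

end

theory Submission
  imports Defs
begin

text \<open>If \<open>p\<close> maximizes \<open>log_lik u\<close> on the model, then \<open>log_lik u\<close> is stationary at \<open>p\<close> along every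
  curve in the model, by Fermat's criterion. Its derivative along a curve with velocity \<open>v\<close> is the
  inner product of \<open>v\<close> with \<open>log_lik_grad u p\<close>, so \<open>u\<close> is log-normal at \<open>p\<close>
  (\<open>log_voronoi_cell_subset_log_normal_space\<close>).

  Conversely, log-normality of \<open>u\<close> only says that \<open>p\<close> is a critical point of
  \<open>log_lik u\<close> on the model, and it is the log-linear structure that makes \<open>p\<close> a global
  maximizer. Let \<open>q\<close> be another point of the model and \<open>w = log q - log p\<close>. Since the
  row span is a linear space that contains \<open>w\<close> and the all-ones vector, the exponential family
  obtained by tilting \<open>p\<close> by \<open>exp (t w)\<close> and normalizing stays in the model
  (\<open>exp_tilt_in_log_linear_model\<close>). Its velocity at \<open>t = 0\<close> is \<open>p\<^sub>i
  (w\<^sub>i - c)\<close>, where \<open>c\<close> is the mean of \<open>w\<close> under \<open>p\<close>.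
  Orthogonality of this velocity to \<open>(u\<^sub>i / p\<^sub>i)\<close> says that \<open>w\<close> has the
  same mean under \<open>u\<close> as under \<open>p\<close> (\<open>log_normal_space_imp_eq_mean\<close>). The
  mean under \<open>u\<close> is the gain in log-likelihood from \<open>p\<close> to \<open>q\<close>; the mean
  under \<open>p\<close> is minus the Kullback-Leibler divergence of \<open>p\<close> from \<open>q\<close>,
  hence at most \<open>0\<close> (\<open>Gibbs_inequality\<close>). So \<open>q\<close> is not more likely than
  \<open>p\<close>.\<close>

lemma log_voronoi_cell_subset_log_normal_space:
  fixes M :: "(real ^ 'n) set"
  assumes pos: "\<And>i. p $ i > 0"
  shows "log_voronoi_cell M p \<subseteq> log_normal_space M p"
proof
  fix u assume "u \<in> log_voronoi_cell M p"
  then have max: "log_lik u q \<le> log_lik u p" if "q \<in> M" for q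
    using that by (auto simp: log_voronoi_cell_def is_mle_def is_arg_max_def not_less)
  have "inner v (log_lik_grad u p) = 0" if v: "v \<in> tangent_space M p" for v
  proof -
    obtain \<gamma> \<epsilon> where e: "\<epsilon> > 0" and img: "\<gamma> ` {-\<epsilon><..<\<epsilon>} \<subseteq> M" and p: "\<gamma> 0 = p"
      and d: "(\<gamma> has_vector_derivative v) (at 0)"
      using v by (auto simp: tangent_space_def)
    have "((log_lik u \<circ> \<gamma>) has_derivative (\<lambda>h. inner h (log_lik_grad u p)) \<circ> (\<lambda>t. t *\<^sub>R v)) (at 0)"
      using GDERIV_log_lik[of p u, OF pos] d
      by (intro diff_chain_at) (auto simp: has_vector_derivative_def gderiv_def p)
    then have "((log_lik u \<circ> \<gamma>) has_real_derivative inner v (log_lik_grad u p)) (at 0)"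
      by (simp add: has_field_derivative_def o_def mult_commute_abs)
    moreover have "\<forall>t. \<bar>0 - t\<bar> < \<epsilon> \<longrightarrow> (log_lik u \<circ> \<gamma>) t \<le> (log_lik u \<circ> \<gamma>) 0"
    proof (intro allI impI)
      fix t :: real assume "\<bar>0 - t\<bar> < \<epsilon>"
      then have "t \<in> {-\<epsilon><..<\<epsilon>}" by auto
      then have "\<gamma> t \<in> M" using img by blast
      then show "(log_lik u \<circ> \<gamma>) t \<le> (log_lik u \<circ> \<gamma>) 0"
        using max p by simp
    qed
    ultimately show ?thesis
      using DERIV_local_max e by blast
  qed
  then show "u \<in> log_normal_space M p"
    by (auto simp: log_normal_space_def normal_space_def orthogonal_comp_def orthogonal_def)
qed

definition exp_tilt :: "real ^ 'n \<Rightarrow> real ^ 'n \<Rightarrow> real \<Rightarrow> real ^ 'n" where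
  "exp_tilt p w t = (\<chi> i. p $ i * exp (t * w $ i) / (\<Sum>j\<in>UNIV. p $ j * exp (t * w $ j)))"

lemma exp_tilt_normalizer_pos:
  fixes p w :: "real ^ 'n"
  assumes "\<And>i. p $ i > 0"
  shows "(\<Sum>j\<in>UNIV. p $ j * exp (t * w $ j)) > 0"
  using assms by (intro sum_pos) auto

lemma exp_tilt_0:
  assumes "p \<in> open_simplex"
  shows "exp_tilt p w 0 = p"
  using assms by (simp add: exp_tilt_def open_simplex_def)

lemma subspace_row_span: "subspace (row_span A)"
  by (simp add: row_span_def)

text \<open>In logarithmic coordinates tilting adds a multiple of \<open>w\<close>, and normalizing adds a multiple
  of the all-ones vector.\<close>

lemma log_vec_exp_tilt:
  fixes p w :: "real ^ 'n"
  assumes pos: "\<And>i. p $ i > 0"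
  shows "log_vec (exp_tilt p w t) =
    log_vec p + t *\<^sub>R w - ln (\<Sum>j\<in>UNIV. p $ j * exp (t * w $ j)) *\<^sub>R (\<chi> i. 1)"
  using exp_tilt_normalizer_pos[OF pos, of t w] pos
  by (simp add: log_vec_def exp_tilt_def vec_eq_iff ln_div ln_mult less_imp_neq[symmetric])

lemma exp_tilt_in_log_linear_model:
  fixes A :: "int ^ 'n ^ 'm"
  assumes one: "(\<chi> i. 1) \<in> row_span A"
    and p: "p \<in> log_linear_model A" and w: "w \<in> row_span A"
  shows "exp_tilt p w t \<in> log_linear_model A"
proof -
  have pos: "p $ i > 0" for i
    using p by (simp add: log_linear_model_def open_simplex_def)
  note Z = exp_tilt_normalizer_pos[OF pos, of t w]
  have "exp_tilt p w t \<in> open_simplex"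
    using Z pos by (simp add: open_simplex_def exp_tilt_def flip: sum_divide_distrib)
  moreover have "log_vec (exp_tilt p w t) \<in> row_span A"
    unfolding log_vec_exp_tilt[OF pos] using one p w
    by (intro subspace_diff subspace_add subspace_scale subspace_row_span)
      (auto simp: log_linear_model_def)
  ultimately show ?thesis by (simp add: log_linear_model_def)
qed

text \<open>The term subtracted from \<open>w\<^sub>i\<close> is the mean of \<open>w\<close> under the tilted distribution, that is,
  the logarithmic derivative of the normalizer.\<close>

lemma exp_tilt_has_vector_derivative:
  fixes p w :: "real ^ 'n"
  assumes pos: "\<And>i. p $ i > 0"
  shows "(exp_tilt p w has_vector_derivative
    (\<chi> i. exp_tilt p w t $ i * (w $ i - (\<Sum>j\<in>UNIV. exp_tilt p w t $ j * w $ j)))) (at t)"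
proof -
  let ?Z = "\<lambda>t. \<Sum>j\<in>UNIV. p $ j * exp (t * w $ j)"
  have Z: "?Z t \<noteq> 0" using exp_tilt_normalizer_pos[OF pos, of t w] by simp
  have dZ: "(?Z has_real_derivative (\<Sum>j\<in>UNIV. p $ j * (exp (t * w $ j) * w $ j))) (at t)"
    by (auto intro!: derivative_eq_intros sum.cong)
  have mean: "(\<Sum>j\<in>UNIV. exp_tilt p w t $ j * w $ j)
      = (\<Sum>j\<in>UNIV. p $ j * (exp (t * w $ j) * w $ j)) / ?Z t"
    by (simp add: exp_tilt_def sum_divide_distrib mult_ac)
  let ?D = "\<lambda>i. exp_tilt p w t $ i * (w $ i - (\<Sum>j\<in>UNIV. exp_tilt p w t $ j * w $ j))"
  have "((\<lambda>s. p $ i * exp (s * w $ i) / ?Z s) has_real_derivative ?D i) (at t)" for i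
    unfolding mean
    by (rule derivative_eq_intros dZ refl Z)+ (use Z in \<open>simp add: exp_tilt_def field_simps\<close>)
  then have "((\<lambda>s. exp_tilt p w s $ i) has_real_derivative ?D i) (at t)" for i
    by (simp add: exp_tilt_def)
  then have "((\<lambda>s. exp_tilt p w s $ i) has_derivative (\<lambda>h. h * ?D i)) (at t)" for i
    by (simp only: has_field_derivative_def mult_commute_abs)
  then show ?thesis
    unfolding has_vector_derivative_def
    by (subst has_derivative_componentwise_within) (auto simp: Basis_vec_def inner_axis)
qed

lemma exp_tilt_C1_differentiable_on:
  fixes p w :: "real ^ 'n"
  assumes pos: "\<And>i. p $ i > 0"
  shows "exp_tilt p w C1_differentiable_on S"
proof -
  have "continuous_on S (exp_tilt p w)"
    using exp_tilt_has_vector_derivative[OF pos]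
    by (meson continuous_at_imp_continuous_on has_vector_derivative_continuous)
  then show ?thesis
    unfolding C1_differentiable_on_def
    by (intro exI[of _ "\<lambda>t. \<chi> i. exp_tilt p w t $ i * (w $ i - (\<Sum>j\<in>UNIV. exp_tilt p w t $ j * w $ j))"]
          conjI ballI exp_tilt_has_vector_derivative[OF pos])
      (auto intro!: continuous_intros)
qed

lemma exp_tilt_velocity_in_tangent_space:
  fixes A :: "int ^ 'n ^ 'm"
  assumes one: "(\<chi> i. 1) \<in> row_span A"
    and p: "p \<in> log_linear_model A" and w: "w \<in> row_span A"
  shows "(\<chi> i. p $ i * (w $ i - (\<Sum>j\<in>UNIV. p $ j * w $ j))) \<in> tangent_space (log_linear_model A) p"
proof -
  have simplex: "p \<in> open_simplex" and pos: "p $ i > 0" for i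
    using p by (simp_all add: log_linear_model_def open_simplex_def)
  show ?thesis
    unfolding tangent_space_def
    using exp_tilt_has_vector_derivative[OF pos, of w 0]
    by (intro CollectI exI[of _ "exp_tilt p w"] exI[of _ "1 :: real"])
      (auto simp: exp_tilt_0[OF simplex]
        intro: exp_tilt_C1_differentiable_on[OF pos] exp_tilt_in_log_linear_model[OF one p w])
qed

lemma Gibbs_inequality:
  fixes p q :: "real ^ 'n"
  assumes p: "p \<in> open_simplex" and q: "q \<in> open_simplex"
  shows "(\<Sum>j\<in>UNIV. p $ j * (ln (q $ j) - ln (p $ j))) \<le> 0"
proof -
  have "p $ j * (ln (q $ j) - ln (p $ j)) \<le> q $ j - p $ j" for j
  proof -
    have pos: "p $ j > 0" "q $ j > 0" using p q by (auto simp: open_simplex_def)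
    then have "ln (q $ j) - ln (p $ j) \<le> q $ j / p $ j - 1"
      using ln_le_minus_one[of "q $ j / p $ j"] by (simp add: ln_div)
    then have "p $ j * (ln (q $ j) - ln (p $ j)) \<le> p $ j * (q $ j / p $ j - 1)"
      using pos by (intro mult_left_mono) auto
    also have "\<dots> = q $ j - p $ j" using pos by (simp add: right_diff_distrib)
    finally show ?thesis .
  qed
  then have "(\<Sum>j\<in>UNIV. p $ j * (ln (q $ j) - ln (p $ j))) \<le> (\<Sum>j\<in>UNIV. q $ j - p $ j)"
    by (rule sum_mono)
  also have "\<dots> = 0" using p q by (simp add: sum_subtractf open_simplex_def)
  finally show ?thesis .
qed

text \<open>This is one half of Birch's theorem: at a critical point the data and the model agree on the
  sufficient statistics. The tilts of \<open>p\<close> supply the tangent vectors to test against; dividing by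
  \<open>p\<^sub>i\<close> in the gradient cancels the factor \<open>p\<^sub>i\<close> of their velocities.\<close>

lemma log_normal_space_imp_eq_mean:
  fixes A :: "int ^ 'n ^ 'm"
  assumes one: "(\<chi> i. 1) \<in> row_span A"
    and p: "p \<in> log_linear_model A" and w: "w \<in> row_span A"
    and u: "u \<in> log_normal_space (log_linear_model A) p" and u1: "(\<Sum>i\<in>UNIV. u $ i) = 1"
  shows "(\<Sum>i\<in>UNIV. u $ i * w $ i) = (\<Sum>i\<in>UNIV. p $ i * w $ i)"
proof -
  let ?c = "\<Sum>j\<in>UNIV. p $ j * w $ j"
  have pos: "p $ i > 0" for i
    using p by (simp add: log_linear_model_def open_simplex_def)
  have "inner (\<chi> i. p $ i * (w $ i - ?c)) (log_lik_grad u p) = 0"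
    using u exp_tilt_velocity_in_tangent_space[OF one p w]
    by (auto simp: log_normal_space_def normal_space_def orthogonal_comp_def orthogonal_def)
  moreover have "inner (\<chi> i. p $ i * (w $ i - ?c)) (log_lik_grad u p) = (\<Sum>i\<in>UNIV. u $ i * (w $ i - ?c))"
    using pos by (simp add: inner_vec_def log_lik_grad_def less_imp_neq[symmetric] mult_ac)
  moreover have "(\<Sum>i\<in>UNIV. u $ i * (w $ i - ?c)) = (\<Sum>i\<in>UNIV. u $ i * w $ i) - ?c"
    by (simp add: right_diff_distrib sum_subtractf u1 flip: sum_distrib_right)
  ultimately show ?thesis by simp
qed

theorem theorem10:
  fixes A :: "int ^ 'n ^ 'm" and p :: "real ^ 'n"
  assumes "(\<chi> i. 1) \<in> row_span A"
    and "p \<in> log_linear_model A"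
  shows "log_voronoi_cell (log_linear_model A) p =
    log_normal_space (log_linear_model A) p \<inter> open_simplex"
proof
  have "p $ i > 0" for i
    using assms(2) by (simp add: log_linear_model_def open_simplex_def)
  then show "log_voronoi_cell (log_linear_model A) p \<subseteq>
      log_normal_space (log_linear_model A) p \<inter> open_simplex"
    using log_voronoi_cell_subset_log_normal_space[of p "log_linear_model A"]
    by (auto simp: log_voronoi_cell_def)
next
  show "log_normal_space (log_linear_model A) p \<inter> open_simplex \<subseteq>
      log_voronoi_cell (log_linear_model A) p"
  proof
    fix u assume u: "u \<in> log_normal_space (log_linear_model A) p \<inter> open_simplex"
    have "log_lik u q \<le> log_lik u p" if q: "q \<in> log_linear_model A" for q
    proof -
      let ?w = "log_vec q - log_vec p"
      have w: "?w \<in> row_span A"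
        using q assms(2) by (auto simp: log_linear_model_def intro: subspace_diff[OF subspace_row_span])
      have "log_lik u q - log_lik u p = (\<Sum>i\<in>UNIV. u $ i * ?w $ i)"
        by (simp add: log_lik_def log_vec_def right_diff_distrib sum_subtractf)
      also have "\<dots> = (\<Sum>i\<in>UNIV. p $ i * ?w $ i)"
        using u by (intro log_normal_space_imp_eq_mean[OF assms w]) (auto simp: open_simplex_def)
      also have "\<dots> \<le> 0"
        using Gibbs_inequality[of p q] q assms(2) by (simp add: log_vec_def log_linear_model_def)
      finally show ?thesis by simp
    qed
    then show "u \<in> log_voronoi_cell (log_linear_model A) p"
      using u assms(2) by (auto simp: log_voronoi_cell_def is_mle_def is_arg_max_def not_less)
  qed
qed

end
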